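(* Consider the system $x(t+1)=A^*x(t)+B^*u(t)+w(t)$ with $x(t)\in\mathbb{R}^n$, $u(t)\in\mathbb{R}^m$, $w(t)\in\mathcal{Z}_w\subset\mathbb{R}^n$, and put $p=n+m$. Assume: (1) $\theta^*=[A^*\ \ B^*]$ is unknown but belongs to a constrained matrix zonotope $\mathcal{M}_{prior}=\langle G^\theta,C^\theta,A^\theta,B^\theta\rangle$ with $s_\theta$ generators, $C^\theta\in\mathbb{R}^{n\times(n+m)}$, $G^\theta\in\mathbb{R}^{n\times(n+m)s_\theta}$, $A^\theta\in\mathbb{R}^{n_\theta\times m_\theta s_\theta}$, $B^\theta\in\mathbb{R}^{n_\theta\times m_\theta}$; (2) $(A^*,B^* )$ is stabilizable; (3) $\mathcal{Z}_w=\langle G^h,c^h\rangle$ is a zonotope with $G^h\in\mathbb{R}^{n\times s_w}$, $c^h\in\mathbb{R}^n$; (4) data $U^0=[u(0)\cdots u(T-1)]$, $X^0=[x(0)\cdots x(T-1)]$, $X^1=[x(1)\cdots x(T)]$ are collected from the system (with some unknown disturbances $w(0),\dots,w(T-1)\in\mathcal{Z}_w$), and $D^0=\begin{bmatrix} X^0 \\ U^0 \end{bmatrix}\in\mathbb{R}^{p\times T}$ has full row rank. Let $\mathcal{M}_{\mathcal{Z}_w^T}=\langle G^w,C^w\rangle$ be the matrix zonotope of disturbance sequences (see context), let $K\in\mathbb{R}^{m\times n}$ be a gain, and let $V^K\in\mathbb{R}^{T\times n}$ satisfy $$\begin{bmatrix} I_n \\ K \end{bmatrix}=D^0V^K.$$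 Define $$\Sigma_{X,U^0}=\{\theta\in\mathcal{M}_{prior}:\ X^1=\theta D^0+W^0\ \text{for some}\ W^0\in\mathcal{M}_{\mathcal{Z}_w^T}\},$$ $$\Sigma^K_{X,U^0}=\{A+BK:\ [A\ \ B]\in\Sigma_{X,U^0}\}.$$ Then $\Sigma^K_{X,U^0}$ is exactly equal to the constrained matrix zonotope of dimension $(n,n)$ with $s_c=s_\theta+Ts_w$ generators $$\mathcal{M}_{cl}=\Big\langle\big[-G^w\circ V^K\ \ \ \mathbf{0}_{n\times ns_\theta}\big],\ (X^1-C^w)V^K,\ A^C,\ B^C\Big\rangle,$$ $$A^C=\begin{bmatrix}\bar A^w&\mathbf{0}\\ \mathbf{0}&\bar A^\theta\\ \bar G^w&-\bar G^\theta\end{bmatrix},\qquad B^C=\begin{bmatrix}\bar B^w\\ \bar B^\theta\\ \bar C^\theta-\bar C^w\end{bmatrix},$$ where, with $b=\max(T,m_\theta)$, the matrices with bars are obtained by appending zero columns on the right of every block so that each block has exactly $b$ columns, as follows: - $\bar A^w$ and $\bar B^w$ are the zero-paddings of $A^w=G^w\circ(D^0)^\bot\in\mathbb{R}^{n\times(T-p)Ts_w}$ (consisting of $Ts_w$ blocks of size $n\times(T-p)$) and $B^w=(X^1-C^w)(D^0)^\bot\in\mathbb{R}^{n\times(T-p)}$; - $\bar A^\theta$ and $\bar B^\theta$ are the zero-paddings of $A^\theta$ ($s_\theta$ blocks of size $n_\theta\times m_\theta$) and $B^\theta$; - $\bar G^w$ and $\bar C^w$ are the zero-paddings of $G^w$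 ($Ts_w$ blocks of size $n\times T$) and $C^w$; - $\bar G^\theta$ and $\bar C^\theta$ are the zero-paddings of $-G^\theta\circ D^0$ ($s_\theta$ blocks of size $n\times T$) and $X^1-C^\theta D^0$. Moreover, $\mathcal{M}_{cl}$ is non-empty and compact.
   Context: Norms: $\|\zeta\|$ is the infinity norm of a vector. Block notation: a generator matrix $G\in\mathbb{R}^{n\times ms}$ is viewed as $G=[G_{:,1},\dots,G_{:,s}]$ with blocks $G_{:,i}\in\mathbb{R}^{n\times m}$; similarly for constraint matrices. For $N\in\mathbb{R}^{m\times q}$, $G\circ N=G(I_s\otimes N)=[G_{:,1}N,\dots,G_{:,s}N]$. Zonotope: $\langle G,c\rangle=\{G\zeta+c:\|\zeta\|\le1\}$ for $G\in\mathbb{R}^{n\times s}$, $c\in\mathbb{R}^n$. Matrix zonotope: $\langle G,C\rangle=\{C+\sum_{i=1}^sG_{:,i}\zeta_i:\ \|\zeta\|\le1\}$. Constrained matrix zonotope (CMZ) of dimension $(n,m)$ with $s$ generators: $\langle G,C,\bar A,\bar B\rangle=\{C+\sum_{i=1}^sG_{:,i}\zeta_i:\ \zeta\in\mathbb{R}^s,\ \|\zeta\|\le1,\ \sum_{i=1}^s\bar A_{:,i}\zeta_i=\bar B\}$, where $G_{:,i},C\in\mathbb{R}^{n\times m}$ and $\bar A_{:,i},\bar B\in\mathbb{R}^{n_c\times m_c}$. Disturbance sequences: $\mathcal{M}_{\mathcal{Z}_w^T}=\langle G^w,C^w\rangle$ is the $T$-fold concatenation of $\mathcal{Z}_w$,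 i.e. the set of all $n\times T$ matrices whose columns all lie in $\mathcal{Z}_w$. Here $C^w=[c^h\ \cdots\ c^h]\in\mathbb{R}^{n\times T}$, and $G^w$ has $Ts_w$ blocks $G^w_{:,k}\in\mathbb{R}^{n\times T}$, one for each pair $(i,j)$ with $1\le i\le s_w$, $1\le j\le T$, namely the matrix whose $j$-th column is the $i$-th column of $G^h$ and whose other columns are zero. $(D^0)^\bot$ denotes a matrix whose columns form a basis of the kernel of $D^0$ (so it has $T-p$ columns). The zero blocks in $A^C$ have sizes $n\times bs_\theta$ (top right) and $n_\theta\times bTs_w$ (middle left). *)

theory Defs
  imports
    "HOL-Analysis.Function_Topology"
    "Jordan_Normal_Form.Matrix_Kernel"
    "Jordan_Normal_Form.DL_Rank"
    "Jordan_Normal_Form.Spectral_Radius"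
begin

definition append_cols :: "'a::zero mat \<Rightarrow> 'a mat \<Rightarrow> 'a mat" (infixr \<open>@\<^sub>c\<close> 70) where
  "A @\<^sub>c B = four_block_mat A B (0\<^sub>m 0 (dim_col A)) (0\<^sub>m 0 (dim_col B))"

(* Inserting 0 only matters for the vector of dimension 0. *)
definition inf_norm :: "real vec \<Rightarrow> real" where
  "inf_norm v = Max (insert 0 (abs ` set\<^sub>v v))"

(* Block indices start at 0: for G with blocks of q columns, block q G i consists of the
   columns i * q, ..., i * q + q - 1. *)
definition block :: "nat \<Rightarrow> 'a mat \<Rightarrow> nat \<Rightarrow> 'a mat" where
  "block q G i = mat (dim_row G) q (\<lambda>(r, c). G $$ (r, i * q + c))"

definition of_blocks :: "nat \<Rightarrow> nat \<Rightarrow> nat \<Rightarrow> (nat \<Rightarrow> 'a mat) \<Rightarrow> 'a mat" where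
  "of_blocks n q s F = mat n (q * s) (\<lambda>(r, c). F (c div q) $$ (r, c mod q))"

(* The number s of blocks is an explicit argument because it cannot be recovered from the
   dimensions when the blocks have no columns. *)
definition block_mult :: "nat \<Rightarrow> 'a::semiring_0 mat \<Rightarrow> 'a mat \<Rightarrow> 'a mat" where
  "block_mult s G N = of_blocks (dim_row G) (dim_col N) s (\<lambda>i. block (dim_row N) G i * N)"

definition pad_cols :: "nat \<Rightarrow> 'a::zero mat \<Rightarrow> 'a mat" where
  "pad_cols b M = mat (dim_row M) b (\<lambda>(r, c). if c < dim_col M then M $$ (r, c) else 0)"

definition pad_blocks :: "nat \<Rightarrow> nat \<Rightarrow> nat \<Rightarrow> 'a::zero mat \<Rightarrow> 'a mat" where
  "pad_blocks q b s G = of_blocks (dim_row G) b s (\<lambda>i. pad_cols b (block q G i))"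

definition gen_comb :: "nat \<Rightarrow> nat \<Rightarrow> real mat \<Rightarrow> real vec \<Rightarrow> real mat" where
  "gen_comb q s G \<zeta> = mat (dim_row G) q (\<lambda>rc. \<Sum>i<s. block q G i $$ rc * \<zeta> $ i)"

definition zonotope :: "real mat \<Rightarrow> real vec \<Rightarrow> real vec set" where
  "zonotope G c = {G *\<^sub>v \<zeta> + c | \<zeta>. \<zeta> \<in> carrier_vec (dim_col G) \<and> inf_norm \<zeta> \<le> 1}"

(* The block width of G is that of the centre C, and similarly for the constraint matrix. *)
definition matrix_zonotope :: "nat \<Rightarrow> real mat \<Rightarrow> real mat \<Rightarrow> real mat set" where
  "matrix_zonotope s G C =
     {C + gen_comb (dim_col C) s G \<zeta> | \<zeta>. \<zeta> \<in> carrier_vec s \<and> inf_norm \<zeta> \<le> 1}"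

definition cmz :: "nat \<Rightarrow> real mat \<Rightarrow> real mat \<Rightarrow> real mat \<Rightarrow> real mat \<Rightarrow> real mat set" where
  "cmz s G C A B =
     {C + gen_comb (dim_col C) s G \<zeta> | \<zeta>.
        \<zeta> \<in> carrier_vec s \<and> inf_norm \<zeta> \<le> 1 \<and> gen_comb (dim_col B) s A \<zeta> = B}"

(* (G, C, A, B) describes a constrained matrix zonotope of dimension (n, m) with s generators
   and constraints of size nc x mc. *)
definition cmz_data ::
  "nat \<Rightarrow> nat \<Rightarrow> nat \<Rightarrow> nat \<Rightarrow> nat \<Rightarrow> real mat \<Rightarrow> real mat \<Rightarrow> real mat \<Rightarrow> real mat \<Rightarrow> bool" where
  "cmz_data n m nc mc s G C A B \<longleftrightarrow>
     G \<in> carrier_mat n (m * s) \<and> C \<in> carrier_mat n m \<and>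
     A \<in> carrier_mat nc (mc * s) \<and> B \<in> carrier_mat nc mc"

(* Block k belongs to the pair e k = (i, j) and has column i of Gh as its column j; e is the
   chosen enumeration of the pairs. *)
definition disturbance_gens :: "(nat \<Rightarrow> nat \<times> nat) \<Rightarrow> nat \<Rightarrow> real mat \<Rightarrow> real mat" where
  "disturbance_gens e T Gh =
     of_blocks (dim_row Gh) T (T * dim_col Gh)
       (\<lambda>k. mat (dim_row Gh) T (\<lambda>(r, c). if c = snd (e k) then Gh $$ (r, fst (e k)) else 0))"

definition stabilizable :: "nat \<Rightarrow> nat \<Rightarrow> real mat \<Rightarrow> real mat \<Rightarrow> bool" where
  "stabilizable n m A B \<longleftrightarrow>
     (\<exists>K \<in> carrier_mat m n. \<forall>z \<in> spectrum (map_mat complex_of_real (A + B * K)). cmod z < 1)"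

(* The Euclidean topology on n x m matrices, transported along the entry map, since the type of
   matrices carries no topology. *)
definition mat_topology :: "nat \<Rightarrow> nat \<Rightarrow> real mat topology" where
  "mat_topology n m =
     pullback_topology (carrier_mat n m) (\<lambda>M. \<lambda>rc \<in> {..<n} \<times> {..<m}. M $$ rc)
       (product_topology (\<lambda>_. euclideanreal) ({..<n} \<times> {..<m}))"

end

(* For zeta = (y, z) put theta = C^theta + G^theta z and W = C^w + G^w y. The last block row of the
   constraint says X1 = theta D0 + W; it implies the first one, as (X1 - W) Dperp = theta D0 Dperp = 0.
   The point of M_cl with parameter zeta is (X1 - W) V = theta D0 V = theta [I; K] = A + B K. M_cl contains
   the closed-loop matrix of the true system and is a continuous image of a closed subset of a cube. *)
theory Submission
  imports Defs
begin

text \<open>The block rows of \<open>AC\<close> have distinct tasks. The first says that X1 - W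
  vanishes on the kernel of D0, so that X1 - W = \<theta>' D0 for some matrix \<theta>'; the second
  puts the parameter z into the prior set; the third couples y and z by requiring the matrix C^theta
  + G^theta z to serve as \<theta>'. The value in the closed loop is then read off from y alone,
  which is why the generators belonging to z are zero.

  The obstacle is notational: everything is packed into block matrices, padded to a common width so
  that rows of different kinds can be stacked. Each packing operation (\<open>block_mult\<close>,
  \<open>pad_blocks\<close>, \<open>append_cols\<close>, \<open>append_rows\<close>) therefore gets
  a lemma on how \<open>gen_comb\<close> passes through it. Padding to b = max T m^theta columns
  loses nothing, since every block width T - p, m^theta, T is at most b; hence the stacked equation
  decouples into three equations between unpadded matrices.\<close>

lemma index_block:
  assumes "r < dim_row G" "c < q"
  shows "block q G i $$ (r, c) = G $$ (r, i * q + c)"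
  using assms by (simp add: block_def)

lemma block_index_less:
  fixes c q k s :: nat
  assumes "c < q" "k < s"
  shows "k * q + c < q * s"
proof -
  have "k * q + c < Suc k * q" using assms by simp
  also have "\<dots> \<le> s * q" using assms by (intro mult_le_mono1) simp
  finally show ?thesis by (simp add: mult.commute)
qed

lemma of_blocks_carrier [simp]: "of_blocks n q s F \<in> carrier_mat n (q * s)"
  by (simp add: of_blocks_def)

lemma index_of_blocks:
  assumes "r < n" "c < q" "k < s"
  shows "of_blocks n q s F $$ (r, k * q + c) = F k $$ (r, c)"
  using assms block_index_less[of c q k s] by (simp add: of_blocks_def)

section \<open>Linear combinations of generator blocks\<close>

lemma gen_comb_carrier: "G \<in> carrier_mat n l \<Longrightarrow> gen_comb q s G \<zeta> \<in> carrier_mat n q"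
  by (simp add: gen_comb_def)

lemma dim_gen_comb [simp]:
  "dim_row (gen_comb q s G \<zeta>) = dim_row G" "dim_col (gen_comb q s G \<zeta>) = q"
  by (simp_all add: gen_comb_def)

lemma index_gen_comb:
  assumes "r < dim_row G" "c < q"
  shows "gen_comb q s G \<zeta> $$ (r, c) = (\<Sum>k<s. G $$ (r, k * q + c) * \<zeta> $ k)"
  using assms by (simp add: gen_comb_def index_block)

lemma gen_comb_of_blocks:
  assumes "r < n" "c < q"
  shows "gen_comb q s (of_blocks n q s F) \<zeta> $$ (r, c) = (\<Sum>k<s. F k $$ (r, c) * \<zeta> $ k)"
proof -
  have "dim_row (of_blocks n q s F) = n" by (simp add: of_blocks_def)
  then show ?thesis using assms by (simp add: index_gen_comb index_of_blocks)
qed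

lemma gen_comb_zero: "gen_comb q s (0\<^sub>m n (q * s)) \<zeta> = 0\<^sub>m n q"
  by (rule eq_matI) (simp_all add: index_gen_comb block_index_less)

lemma gen_comb_uminus:
  assumes "G \<in> carrier_mat n (q * s)"
  shows "gen_comb q s (- G) \<zeta> = - gen_comb q s G \<zeta>"
  using assms
  by (intro eq_matI) (simp_all add: index_gen_comb block_index_less sum_negf)

lemma block_mult_carrier:
  "G \<in> carrier_mat n l \<Longrightarrow> N \<in> carrier_mat q t \<Longrightarrow> block_mult s G N \<in> carrier_mat n (t * s)"
  unfolding block_mult_def by (metis carrier_matD of_blocks_carrier)

text \<open>Right multiplication is linear, so the common factor N can be pulled out of the
  combination; entrywise this exchanges the sum over the blocks with the inner sum of the matrix
  product. It is applied with V, \<open>Dperp\<close> and \<open>D0\<close> as N.\<close>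

lemma gen_comb_block_mult:
  assumes G: "G \<in> carrier_mat n l" and N: "N \<in> carrier_mat q t"
  shows "gen_comb t s (block_mult s G N) \<zeta> = gen_comb q s G \<zeta> * N"
proof (rule eq_matI)
  fix r c assume "r < dim_row (gen_comb q s G \<zeta> * N)" "c < dim_col (gen_comb q s G \<zeta> * N)"
  then have r: "r < n" and c: "c < t" using G N by auto
  have "gen_comb t s (block_mult s G N) \<zeta> $$ (r, c) =
      (\<Sum>k<s. (\<Sum>j<q. G $$ (r, k * q + j) * N $$ (j, c)) * \<zeta> $ k)"
    using G N r c
    by (simp add: block_mult_def gen_comb_of_blocks scalar_prod_def lessThan_atLeast0 index_block
        block_def)
  also have "\<dots> = (\<Sum>j<q. (\<Sum>k<s. G $$ (r, k * q + j) * \<zeta> $ k) * N $$ (j, c))"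
    unfolding sum_distrib_right by (subst sum.swap) (simp add: mult_ac)
  also have "\<dots> = (gen_comb q s G \<zeta> * N) $$ (r, c)"
    using G N r c by (simp add: scalar_prod_def lessThan_atLeast0 index_gen_comb)
  finally show "gen_comb t s (block_mult s G N) \<zeta> $$ (r, c) = (gen_comb q s G \<zeta> * N) $$ (r, c)" .
qed (use G N in \<open>auto simp: block_mult_def of_blocks_def\<close>)

section \<open>Zero padding\<close>

lemma pad_cols_carrier [simp]: "M \<in> carrier_mat n q \<Longrightarrow> pad_cols b M \<in> carrier_mat n b"
  by (simp add: pad_cols_def)

text \<open>When q is at most b, the first q columns of the padded matrix are the original, so
  equations can be freed from padding.\<close>

lemma pad_cols_inject:
  assumes "M \<in> carrier_mat n q" "N \<in> carrier_mat n q" "q \<le> b"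
  shows "pad_cols b M = pad_cols b N \<longleftrightarrow> M = N"
proof
  assume eq: "pad_cols b M = pad_cols b N"
  show "M = N"
  proof (rule eq_matI)
    fix i j assume "i < dim_row N" "j < dim_col N"
    then show "M $$ (i, j) = N $$ (i, j)"
      using arg_cong[OF eq, of "\<lambda>X. X $$ (i, j)"] assms by (simp add: pad_cols_def)
  qed (use assms in auto)
qed simp

lemma pad_cols_add:
  "M \<in> carrier_mat n q \<Longrightarrow> N \<in> carrier_mat n q \<Longrightarrow>
    pad_cols b (M + N :: 'a :: monoid_add mat) = pad_cols b M + pad_cols b N"
  by (intro eq_matI) (auto simp: pad_cols_def)

lemma pad_cols_uminus: "- pad_cols b M = pad_cols b (- M :: 'a :: group_add mat)"
  by (intro eq_matI) (auto simp: pad_cols_def)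

lemma pad_cols_minus:
  "M \<in> carrier_mat n q \<Longrightarrow> N \<in> carrier_mat n q \<Longrightarrow>
    pad_cols b (M - N :: 'a :: group_add mat) = pad_cols b M - pad_cols b N"
  by (intro eq_matI) (auto simp: pad_cols_def)

lemma pad_blocks_carrier: "G \<in> carrier_mat n l \<Longrightarrow> pad_blocks q b s G \<in> carrier_mat n (b * s)"
  unfolding pad_blocks_def by (metis carrier_matD(1) of_blocks_carrier)

text \<open>Padding is linear and puts its zeros at the same places in every block, hence it
  commutes with the combination.\<close>

lemma gen_comb_pad_blocks: "gen_comb b s (pad_blocks q b s G) \<zeta> = pad_cols b (gen_comb q s G \<zeta>)"
proof (rule eq_matI)
  fix r c assume "r < dim_row (pad_cols b (gen_comb q s G \<zeta>))"
    "c < dim_col (pad_cols b (gen_comb q s G \<zeta>))"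
  then have "r < dim_row G" "c < b" by (simp_all add: pad_cols_def)
  then show "gen_comb b s (pad_blocks q b s G) \<zeta> $$ (r, c) = pad_cols b (gen_comb q s G \<zeta>) $$ (r, c)"
    by (simp add: pad_blocks_def gen_comb_of_blocks)
      (simp add: pad_cols_def block_def index_gen_comb)
qed (simp_all add: pad_blocks_def pad_cols_def of_blocks_def)

section \<open>Concatenation of block matrices\<close>

lemma append_cols_carrier [simp]:
  "A \<in> carrier_mat n k \<Longrightarrow> B \<in> carrier_mat n l \<Longrightarrow> A @\<^sub>c B \<in> carrier_mat n (k + l)"
  by (auto simp: append_cols_def)

lemma index_append_cols:
  assumes "A \<in> carrier_mat n k" "B \<in> carrier_mat n l" "r < n" "c < k + l"
  shows "(A @\<^sub>c B) $$ (r, c) = (if c < k then A $$ (r, c) else B $$ (r, c - k))"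
  using assms by (auto simp: append_cols_def)

lemma index_append_rows:
  assumes "A \<in> carrier_mat k n" "B \<in> carrier_mat l n" "r < k + l" "c < n"
  shows "(A @\<^sub>r B) $$ (r, c) = (if r < k then A $$ (r, c) else B $$ (r - k, c))"
  using assms by (auto simp: append_rows_def)

lemma append_rows_inject:
  assumes "A \<in> carrier_mat k n" "A' \<in> carrier_mat k n" "B \<in> carrier_mat l n" "B' \<in> carrier_mat l n"
  shows "A @\<^sub>r B = A' @\<^sub>r B' \<longleftrightarrow> A = A' \<and> B = B'"
proof
  assume eq: "A @\<^sub>r B = A' @\<^sub>r B'"
  have *: "(A @\<^sub>r B) $$ (r, c) = (A' @\<^sub>r B') $$ (r, c)" for r c by (simp add: eq)
  have "A = A'"
  proof (rule eq_matI)
    fix i j assume "i < dim_row A'" "j < dim_col A'"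
    then show "A $$ (i, j) = A' $$ (i, j)"
      using *[of i j] assms by (simp add: index_append_rows[where k = k and n = n and l = l])
  qed (use assms in auto)
  moreover have "B = B'"
  proof (rule eq_matI)
    fix i j assume "i < dim_row B'" "j < dim_col B'"
    then show "B $$ (i, j) = B' $$ (i, j)"
      using *[of "k + i" j] assms by (simp add: index_append_rows[where k = k and n = n and l = l])
  qed (use assms in auto)
  ultimately show "A = A' \<and> B = B'" ..
qed simp

lemma sum_lessThan_add:
  fixes f :: "nat \<Rightarrow> 'a :: comm_monoid_add"
  shows "(\<Sum>i<k + l. f i) = (\<Sum>i<k. f i) + (\<Sum>i<l. f (k + i))"
  by (induction l) (simp_all add: add.assoc)

text \<open>All blocks on both sides have the same width q, so block k + i of the concatenation
  starts at column k * q + i * q and is block i of B. The sum over k + l blocks thus splits at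
  k.\<close>

lemma gen_comb_append_cols:
  assumes A: "A \<in> carrier_mat n (q * k)" and B: "B \<in> carrier_mat n (q * l)"
    and y: "y \<in> carrier_vec k" and z: "z \<in> carrier_vec l"
  shows "gen_comb q (k + l) (A @\<^sub>c B) (y @\<^sub>v z) = gen_comb q k A y + gen_comb q l B z"
proof (rule eq_matI)
  fix r c assume "r < dim_row (gen_comb q k A y + gen_comb q l B z)"
    "c < dim_col (gen_comb q k A y + gen_comb q l B z)"
  then have r: "r < n" and c: "c < q" using B by auto
  have AB: "A @\<^sub>c B \<in> carrier_mat n (q * k + q * l)" using A B by simp
  have "gen_comb q (k + l) (A @\<^sub>c B) (y @\<^sub>v z) $$ (r, c) =
      (\<Sum>i<k. (A @\<^sub>c B) $$ (r, i * q + c) * (y @\<^sub>v z) $ i) +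
      (\<Sum>i<l. (A @\<^sub>c B) $$ (r, (k + i) * q + c) * (y @\<^sub>v z) $ (k + i))"
    using index_gen_comb[of r "A @\<^sub>c B" c q] carrier_matD(1)[OF AB] r c
    by (simp only: sum_lessThan_add)
  also have "(\<Sum>i<k. (A @\<^sub>c B) $$ (r, i * q + c) * (y @\<^sub>v z) $ i) = gen_comb q k A y $$ (r, c)"
  proof -
    have "(A @\<^sub>c B) $$ (r, i * q + c) = A $$ (r, i * q + c)" if "i < k" for i
      using block_index_less[OF c that] index_append_cols[OF A B r, of "i * q + c"] by simp
    then show ?thesis using A y z r c by (simp add: index_gen_comb)
  qed
  also have "(\<Sum>i<l. (A @\<^sub>c B) $$ (r, (k + i) * q + c) * (y @\<^sub>v z) $ (k + i)) =
      gen_comb q l B z $$ (r, c)"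
  proof -
    have "(A @\<^sub>c B) $$ (r, (k + i) * q + c) = B $$ (r, i * q + c)" if "i < l" for i
      using block_index_less[OF c that] index_append_cols[OF A B r, of "(k + i) * q + c"]
      by (simp add: algebra_simps)
    then show ?thesis using B y z r c by (simp add: index_gen_comb)
  qed
  finally show "gen_comb q (k + l) (A @\<^sub>c B) (y @\<^sub>v z) $$ (r, c) =
      (gen_comb q k A y + gen_comb q l B z) $$ (r, c)"
    using A B r c by simp
qed (use A B carrier_matD[OF append_cols_carrier[OF A B]] in auto)

lemma gen_comb_append_rows:
  assumes A: "A \<in> carrier_mat k (q * s)" and B: "B \<in> carrier_mat l (q * s)"
  shows "gen_comb q s (A @\<^sub>r B) z = gen_comb q s A z @\<^sub>r gen_comb q s B z"
proof -
  have AB: "A @\<^sub>r B \<in> carrier_mat (k + l) (q * s)" using A B by simp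
  have gA: "gen_comb q s A z \<in> carrier_mat k q" and gB: "gen_comb q s B z \<in> carrier_mat l q"
    using A B by (simp_all add: gen_comb_carrier)
  then have gAB: "gen_comb q s A z @\<^sub>r gen_comb q s B z \<in> carrier_mat (k + l) q" by simp
  show ?thesis
  proof (rule eq_matI)
    fix r c assume "r < dim_row (gen_comb q s A z @\<^sub>r gen_comb q s B z)"
      "c < dim_col (gen_comb q s A z @\<^sub>r gen_comb q s B z)"
    then have r: "r < k + l" and c: "c < q" using gAB by auto
    have "(A @\<^sub>r B) $$ (r, i * q + c) =
        (if r < k then A $$ (r, i * q + c) else B $$ (r - k, i * q + c))" if "i < s" for i
      using index_append_rows[OF A B r block_index_less[OF c that]] .
    then show "gen_comb q s (A @\<^sub>r B) z $$ (r, c) = (gen_comb q s A z @\<^sub>r gen_comb q s B z) $$ (r, c)"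
      using A B r c index_gen_comb[of r "A @\<^sub>r B" c q] carrier_matD(1)[OF AB]
      by (simp add: index_gen_comb index_append_rows[OF gA gB r c])
  qed (use AB gAB in auto)
qed

text \<open>Serves for [A B] applied to [I; K] as well as for the true parameters applied to the
  data [X0; U0].\<close>

lemma append_cols_mult_append_rows:
  fixes A B C D :: "'a :: comm_semiring_1 mat"
  assumes A: "A \<in> carrier_mat n k" and B: "B \<in> carrier_mat n l"
    and C: "C \<in> carrier_mat k t" and D: "D \<in> carrier_mat l t"
  shows "(A @\<^sub>c B) * (C @\<^sub>r D) = A * C + B * D"
proof -
  have AB: "A @\<^sub>c B \<in> carrier_mat n (k + l)" and CD: "C @\<^sub>r D \<in> carrier_mat (k + l) t"
    using assms by auto
  show ?thesis
  proof (rule eq_matI)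
    fix r c assume "r < dim_row (A * C + B * D)" "c < dim_col (A * C + B * D)"
    then have r: "r < n" and c: "c < t" using B D by auto
    have "((A @\<^sub>c B) * (C @\<^sub>r D)) $$ (r, c) = (\<Sum>i<k + l. (A @\<^sub>c B) $$ (r, i) * (C @\<^sub>r D) $$ (i, c))"
      using AB CD r c by (simp add: scalar_prod_def lessThan_atLeast0)
    also have "\<dots> = (\<Sum>i<k + l. if i < k then A $$ (r, i) * C $$ (i, c)
        else B $$ (r, i - k) * D $$ (i - k, c))"
      by (rule sum.cong) (simp_all add: index_append_cols[OF A B r] index_append_rows[OF C D _ c])
    also have "\<dots> = (\<Sum>i<k. A $$ (r, i) * C $$ (i, c)) + (\<Sum>i<l. B $$ (r, i) * D $$ (i, c))"
      by (simp add: sum_lessThan_add)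
    also have "\<dots> = (A * C + B * D) $$ (r, c)"
      using assms r c by (simp add: scalar_prod_def lessThan_atLeast0)
    finally show "((A @\<^sub>c B) * (C @\<^sub>r D)) $$ (r, c) = (A * C + B * D) $$ (r, c)" .
  qed (use AB CD B D in auto)
qed

text \<open>Recovers a pair A, B from an element of the prior set, which is only known as an n x (n
  + m) matrix.\<close>

lemma split_cols:
  assumes "M \<in> carrier_mat n (k + l)"
  obtains A B where "A \<in> carrier_mat n k" "B \<in> carrier_mat n l" "M = A @\<^sub>c B"
proof
  show "M = mat n k (\<lambda>(i, j). M $$ (i, j)) @\<^sub>c mat n l (\<lambda>(i, j). M $$ (i, k + j))"
    using assms by (intro eq_matI) (auto simp: append_cols_def)
qed simp_all

section \<open>Parameter vectors, kernel columns and disturbance sequences\<close>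

text \<open>The 0 inserted into the maximum is below the bound 1, so the equivalence also covers s =
  0.\<close>

lemma inf_norm_le_one_iff:
  assumes "v \<in> carrier_vec s"
  shows "inf_norm v \<le> 1 \<longleftrightarrow> (\<forall>i<s. \<bar>v $ i\<bar> \<le> 1)"
  using assms by (auto simp: inf_norm_def vec_set_def)

text \<open>A cube is the product of its coordinate cubes. This separates the bound on the joint
  parameter into the bounds that define the disturbance set and the prior set.\<close>

lemma inf_norm_append_vec_le_one_iff:
  assumes "y \<in> carrier_vec k" "z \<in> carrier_vec l"
  shows "inf_norm (y @\<^sub>v z) \<le> 1 \<longleftrightarrow> inf_norm y \<le> 1 \<and> inf_norm z \<le> 1"
proof -
  have "(\<forall>i<k + l. P ((y @\<^sub>v z) $ i)) \<longleftrightarrow> (\<forall>i<k. P (y $ i)) \<and> (\<forall>i<l. P (z $ i))" for P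
  proof (intro iffI conjI allI impI)
    fix i assume P: "\<forall>i<k + l. P ((y @\<^sub>v z) $ i)" and i: "i < l"
    then show "P (z $ i)" using assms P[rule_format, of "k + i"] by auto
  qed (use assms in \<open>auto simp: less_diff_conv2 split: if_splits\<close>)
  from this[of "\<lambda>a. \<bar>a\<bar> \<le> 1"] show ?thesis
    unfolding inf_norm_le_one_iff[OF append_carrier_vec[OF assms]]
      inf_norm_le_one_iff[OF assms(1)] inf_norm_le_one_iff[OF assms(2)] .
qed

lemma mat_kernel_cols_mult_zero:
  fixes D :: "'a :: field mat"
  assumes D: "D \<in> carrier_mat p t" and E: "E \<in> carrier_mat t q"
    and sub: "set (cols E) \<subseteq> mat_kernel D"
  shows "D * E = 0\<^sub>m p q"
proof (rule mat_col_eqI)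
  fix i assume i: "i < dim_col (0\<^sub>m p q :: 'a mat)"
  then have "col E i \<in> set (cols E)" using E by (auto simp: cols_def)
  then have "D *\<^sub>v col E i = 0\<^sub>v p" using sub mat_kernelD(2)[OF D] by blast
  moreover have "col (D * E) i = D *\<^sub>v col E i" using i by (intro col_mult2[OF D E]) simp
  ultimately show "col (D * E) i = col (0\<^sub>m p q) i" using i by simp
qed (use D E in auto)

text \<open>Each generator acts on a single column, so the parameters of the T columns can be chosen
  independently and collected into one vector. This places the disturbances that actually occurred
  in the matrix zonotope.\<close>

lemma matrix_zonotope_disturbance_gens:
  assumes Gh: "Gh \<in> carrier_mat n s" and ch: "ch \<in> carrier_vec n"
    and e: "bij_betw e {..<T * s} ({..<s} \<times> {..<T})"
    and W: "W \<in> carrier_mat n T" and cols: "\<And>t. t < T \<Longrightarrow> col W t \<in> zonotope Gh ch"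
  shows "W \<in> matrix_zonotope (T * s) (disturbance_gens e T Gh) (mat_of_cols n (replicate T ch))"
proof -
  have "\<exists>z. z \<in> carrier_vec s \<and> inf_norm z \<le> 1 \<and> col W t = Gh *\<^sub>v z + ch" if "t < T" for t
    using cols[OF that] Gh by (auto simp: zonotope_def)
  then obtain z where z: "\<And>t. t < T \<Longrightarrow> z t \<in> carrier_vec s"
    "\<And>t. t < T \<Longrightarrow> inf_norm (z t) \<le> 1" "\<And>t. t < T \<Longrightarrow> col W t = Gh *\<^sub>v z t + ch"
    by metis
  \<comment> \<open>If \<open>e k\<close> = (i, j), generator k puts column i of \<open>Gh\<close>
    into column j, so its weight is entry i of the parameter \<open>z j\<close> of that
    column.\<close>
  define \<zeta> where "\<zeta> = vec (T * s) (\<lambda>k. z (snd (e k)) $ fst (e k))"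
  have \<zeta>: "\<zeta> \<in> carrier_vec (T * s)" by (simp add: \<zeta>_def)
  have e_mem: "fst (e k) < s" "snd (e k) < T" if "k < T * s" for k
    using bij_betwE[OF e] that by (auto simp: mem_Times_iff)
  have "inf_norm \<zeta> \<le> 1"
    unfolding inf_norm_le_one_iff[OF \<zeta>]
    using e_mem z(2) by (auto simp: \<zeta>_def inf_norm_le_one_iff[OF z(1)])
  moreover have "W = mat_of_cols n (replicate T ch) + gen_comb T (T * s) (disturbance_gens e T Gh) \<zeta>"
    (is "W = ?C + ?H")
  proof (rule eq_matI)
    fix r c assume "r < dim_row (?C + ?H)" "c < dim_col (?C + ?H)"
    then have r: "r < n" and c: "c < T" using Gh by (auto simp: disturbance_gens_def of_blocks_def)
    have "?H $$ (r, c) = (\<Sum>k<T * s.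
        (if c = snd (e k) then Gh $$ (r, fst (e k)) else 0) * z (snd (e k)) $ fst (e k))"
      using r c Gh by (simp add: disturbance_gens_def gen_comb_of_blocks \<zeta>_def)
    \<comment> \<open>The bijection \<open>e\<close> turns the sum over blocks into a sum over
      pairs, of which only those with j = c contribute.\<close>
    also have "\<dots> = (\<Sum>(i, j)\<in>{..<s} \<times> {..<T}. (if c = j then Gh $$ (r, i) else 0) * z j $ i)"
      by (subst sum.reindex_bij_betw[OF e, symmetric]) (simp add: case_prod_beta)
    also have "\<dots> = (\<Sum>i<s. Gh $$ (r, i) * z c $ i)"
      using c by (simp add: if_distrib[of "\<lambda>x. x * _"] flip: sum.cartesian_product cong: if_cong)
    also have "\<dots> = (Gh *\<^sub>v z c) $ r"
      using Gh r z(1)[OF c] by (simp add: scalar_prod_def lessThan_atLeast0)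
    finally have "?H $$ (r, c) = (Gh *\<^sub>v z c) $ r" .
    moreover have "W $$ (r, c) = (Gh *\<^sub>v z c + ch) $ r"
      using W r c z(3)[OF c] by (metis carrier_matD index_col)
    ultimately show "W $$ (r, c) = (?C + ?H) $$ (r, c)"
      using r c ch Gh
      by (simp add: mat_of_cols_index disturbance_gens_def of_blocks_def)
  qed (use W Gh in \<open>auto simp: disturbance_gens_def of_blocks_def\<close>)
  ultimately show ?thesis using \<zeta> by (auto simp: matrix_zonotope_def)
qed

section \<open>Compactness of constrained matrix zonotopes\<close>

lemma continuous_map_linear_form:
  fixes s :: nat
  shows "continuous_map (product_topology (\<lambda>_. euclideanreal) {..<s}) euclideanreal
    (\<lambda>z. \<Sum>k<s. a k * z k)"
  by (rule continuous_map_sum)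
    (auto intro!: continuous_map_real_mult continuous_map_product_projection)

text \<open>Parameters are modelled as functions on {..<s} under the product topology. There the
  cube is compact as a product of intervals, and the matrix constraint becomes finitely many scalar
  linear equations.\<close>

lemma compactin_cmz:
  assumes "cmz_data n m nc mc s G C A B"
  shows "compactin (mat_topology n m) (cmz s G C A B)"
proof -
  have G: "G \<in> carrier_mat n (m * s)" and C: "C \<in> carrier_mat n m"
    and A: "A \<in> carrier_mat nc (mc * s)" and B: "B \<in> carrier_mat nc mc"
    using assms by (auto simp: cmz_data_def)
  define P where "P = product_topology (\<lambda>_. euclideanreal) {..<s}"
  define Q where "Q = (\<Pi>\<^sub>E k\<in>{..<s}. {-1..1::real})"
  \<comment> \<open>One set per entry of the constraint, written as the preimage of a singleton so
    that closedness follows from continuity.\<close>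
  define L where "L = (\<lambda>(i, j). {z \<in> topspace P. (\<Sum>k<s. A $$ (i, k * mc + j) * z k) \<in> {B $$ (i, j)}})"
  \<comment> \<open>With the compact cube \<open>Q\<close> among the intersected sets, the
    intersection is compact even when there are no constraint entries.\<close>
  define S where "S = \<Inter> (insert Q (L ` ({..<nc} \<times> {..<mc})))"
  define f where "f = (\<lambda>z. C + gen_comb m s G (vec s z))"
  have "compactin P Q"
    unfolding P_def Q_def by (simp add: compactin_PiE)
  moreover have "closedin P Q"
    unfolding P_def Q_def by (simp add: closedin_product_topology)
  moreover have "closedin P (L ij)" for ij
    unfolding L_def P_def case_prod_beta
    by (rule closedin_continuous_map_preimage[OF continuous_map_linear_form]) simp
  ultimately have "compactin P S"
    unfolding S_def by (intro closed_compactin_Inter[of P Q]) auto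
  moreover have "continuous_map P (mat_topology n m) f"
    unfolding mat_topology_def
  \<comment> \<open>Continuity into the pullback topology means that every entry of
    \<open>f z\<close> is continuous in z and that \<open>f\<close> takes values in the n x m
    matrices.\<close>
  proof (rule continuous_map_pullback')
    have "continuous_map P euclideanreal (\<lambda>z. f z $$ rc)" if rc_mem: "rc \<in> {..<n} \<times> {..<m}" for rc
    proof -
      obtain r c where rc: "rc = (r, c)" "r < n" "c < m" using rc_mem by auto
      have "(\<lambda>z. f z $$ rc) = (\<lambda>z. C $$ (r, c) + (\<Sum>k<s. G $$ (r, k * m + c) * z k))"
        using rc G C by (simp add: f_def index_gen_comb)
      moreover have "continuous_map P euclideanreal \<dots>"
        unfolding P_def by (intro continuous_map_add continuous_map_linear_form) simp
      ultimately show ?thesis by simp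
    qed
    then show "continuous_map P (product_topology (\<lambda>_. euclideanreal) ({..<n} \<times> {..<m}))
        ((\<lambda>M. \<lambda>rc\<in>{..<n} \<times> {..<m}. M $$ rc) \<circ> f)"
      by (subst continuous_map_componentwise) (auto simp: o_def)
    show "topspace P \<subseteq> f -` carrier_mat n m"
      using G C by (auto simp: f_def gen_comb_carrier)
  qed
  moreover have "cmz s G C A B = f ` S"
  proof (intro equalityI subsetI)
    fix M assume "M \<in> cmz s G C A B"
    then obtain \<zeta> where \<zeta>: "\<zeta> \<in> carrier_vec s" "inf_norm \<zeta> \<le> 1" "gen_comb mc s A \<zeta> = B"
      and M: "M = C + gen_comb m s G \<zeta>"
      using B C by (auto simp: cmz_def)
    \<comment> \<open>The restriction makes z extensional, as membership in \<open>Q\<close> and in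
      the product space demands.\<close>
    define z where "z = (\<lambda>k\<in>{..<s}. \<zeta> $ k)"
    have \<zeta>_eq: "\<zeta> = vec s z" using \<zeta>(1) by (intro eq_vecI) (auto simp: z_def)
    have "z \<in> Q"
      using \<zeta>(2) unfolding inf_norm_le_one_iff[OF \<zeta>(1)] by (auto simp: Q_def z_def abs_le_iff)
    moreover have "z \<in> L (i, j)" if "i < nc" "j < mc" for i j
    proof -
      have "gen_comb mc s A \<zeta> $$ (i, j) = B $$ (i, j)" using \<zeta>(3) by simp
      then show ?thesis using that A by (auto simp: L_def P_def z_def index_gen_comb)
    qed
    ultimately have "z \<in> S" by (auto simp: S_def)
    then show "M \<in> f ` S" using M \<zeta>_eq by (auto simp: f_def)
  next
    fix M assume "M \<in> f ` S"
    then obtain z where z: "z \<in> S" and M: "M = f z" by auto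
    have "inf_norm (vec s z) \<le> 1"
      unfolding inf_norm_le_one_iff[OF vec_carrier] using z by (auto simp: S_def Q_def abs_le_iff)
    moreover have "gen_comb mc s A (vec s z) = B"
    proof (rule eq_matI)
      fix i j assume "i < dim_row B" "j < dim_col B"
      then have ij: "i < nc" "j < mc" using B by auto
      then have "z \<in> L (i, j)" using z by (auto simp: S_def)
      then show "gen_comb mc s A (vec s z) $$ (i, j) = B $$ (i, j)"
        using ij A by (simp add: L_def index_gen_comb)
    qed (use A B in auto)
    ultimately show "M \<in> cmz s G C A B"
      unfolding cmz_def M f_def using B C by (auto intro!: exI[of _ "vec s z"])
  qed
  ultimately show ?thesis by (simp add: image_compactin)
qed

section \<open>The closed-loop set as a constrained matrix zonotope\<close>

theorem theorem1:
  fixes n m p T s\<^sub>\<theta> n\<^sub>\<theta> m\<^sub>\<theta> s\<^sub>w b :: nat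
    and x u w :: "nat \<Rightarrow> real vec"
    and As Bs \<theta>s G\<theta> C\<theta> A\<theta> B\<theta> :: "real mat"
    and Gh :: "real mat" and ch :: "real vec"
    and Gw Cw X0 X1 U0 D0 Dperp K V :: "real mat"
    and enum :: "nat \<Rightarrow> nat \<times> nat"
    and Aw Bw Aw' Bw' A\<theta>' B\<theta>' Gw' Cw' G\<theta>' C\<theta>' AC BC :: "real mat"
    and M_prior M_w \<Sigma> \<Sigma>K M_cl :: "real mat set"
  assumes p: "p = n + m"
    and As: "As \<in> carrier_mat n n" and Bs: "Bs \<in> carrier_mat n m"
    and \<theta>s: "\<theta>s = As @\<^sub>c Bs"
    and prior: "cmz_data n p n\<^sub>\<theta> m\<^sub>\<theta> s\<^sub>\<theta> G\<theta> C\<theta> A\<theta> B\<theta>"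
    and M_prior: "M_prior = cmz s\<^sub>\<theta> G\<theta> C\<theta> A\<theta> B\<theta>"
    and \<theta>s_prior: "\<theta>s \<in> M_prior"
    and stab: "stabilizable n m As Bs"
    and Gh: "Gh \<in> carrier_mat n s\<^sub>w" and ch: "ch \<in> carrier_vec n"
    and x: "\<And>t. t \<le> T \<Longrightarrow> x t \<in> carrier_vec n"
    and u: "\<And>t. t < T \<Longrightarrow> u t \<in> carrier_vec m"
    and w: "\<And>t. t < T \<Longrightarrow> w t \<in> zonotope Gh ch"
    and dyn: "\<And>t. t < T \<Longrightarrow> x (t + 1) = As *\<^sub>v x t + Bs *\<^sub>v u t + w t"
    and U0: "U0 = mat_of_cols m (map u [0..<T])"
    and X0: "X0 = mat_of_cols n (map x [0..<T])"
    and X1: "X1 = mat_of_cols n (map (\<lambda>t. x (t + 1)) [0..<T])"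
    and D0: "D0 = X0 @\<^sub>r U0"
    and full_row_rank: "vec_space.rank p D0 = p"
    and enum: "bij_betw enum {..<T * s\<^sub>w} ({..<s\<^sub>w} \<times> {..<T})"
    and Gw: "Gw = disturbance_gens enum T Gh"
    and Cw: "Cw = mat_of_cols n (replicate T ch)"
    and M_w: "M_w = matrix_zonotope (T * s\<^sub>w) Gw Cw"
    and K: "K \<in> carrier_mat m n"
    and V: "V \<in> carrier_mat T n"
    and K_V: "1\<^sub>m n @\<^sub>r K = D0 * V"
    and \<Sigma>: "\<Sigma> = {\<theta> \<in> M_prior. \<exists>W0 \<in> M_w. X1 = \<theta> * D0 + W0}"
    and \<Sigma>K: "\<Sigma>K = {A + B * K | A B. A \<in> carrier_mat n n \<and> B \<in> carrier_mat n m \<and> A @\<^sub>c B \<in> \<Sigma>}"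
    and Dperp: "Dperp \<in> carrier_mat T (T - p)"
    and Dperp_basis: "distinct (cols Dperp)" "kernel.basis T D0 (set (cols Dperp))"
    and Aw: "Aw = block_mult (T * s\<^sub>w) Gw Dperp"
    and Bw: "Bw = (X1 - Cw) * Dperp"
    and b: "b = max T m\<^sub>\<theta>"
    and Aw': "Aw' = pad_blocks (T - p) b (T * s\<^sub>w) Aw" and Bw': "Bw' = pad_cols b Bw"
    and A\<theta>': "A\<theta>' = pad_blocks m\<^sub>\<theta> b s\<^sub>\<theta> A\<theta>" and B\<theta>': "B\<theta>' = pad_cols b B\<theta>"
    and Gw': "Gw' = pad_blocks T b (T * s\<^sub>w) Gw" and Cw': "Cw' = pad_cols b Cw"
    and G\<theta>': "G\<theta>' = pad_blocks T b s\<^sub>\<theta> (- block_mult s\<^sub>\<theta> G\<theta> D0)"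
    and C\<theta>': "C\<theta>' = pad_cols b (X1 - C\<theta> * D0)"
    and AC: "AC = (Aw' @\<^sub>c 0\<^sub>m n (b * s\<^sub>\<theta>)) @\<^sub>r
                  (0\<^sub>m n\<^sub>\<theta> (b * (T * s\<^sub>w)) @\<^sub>c A\<theta>') @\<^sub>r
                  (Gw' @\<^sub>c (- G\<theta>'))"
    and BC: "BC = Bw' @\<^sub>r B\<theta>' @\<^sub>r (C\<theta>' - Cw')"
    and M_cl: "M_cl = cmz (s\<^sub>\<theta> + T * s\<^sub>w)
                 ((- block_mult (T * s\<^sub>w) Gw V) @\<^sub>c 0\<^sub>m n (n * s\<^sub>\<theta>)) ((X1 - Cw) * V) AC BC"
  shows "cmz_data n n (n + n\<^sub>\<theta> + n) b (s\<^sub>\<theta> + T * s\<^sub>w)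
           ((- block_mult (T * s\<^sub>w) Gw V) @\<^sub>c 0\<^sub>m n (n * s\<^sub>\<theta>)) ((X1 - Cw) * V) AC BC \<and>
    \<Sigma>K = M_cl \<and>
    M_cl \<noteq> {} \<and>
    compactin (mat_topology n n) M_cl"
proof -
  let ?S = "T * s\<^sub>w"
  let ?Gcl = "(- block_mult ?S Gw V) @\<^sub>c 0\<^sub>m n (n * s\<^sub>\<theta>)"
  let ?Ccl = "(X1 - Cw) * V"
  have G\<theta>: "G\<theta> \<in> carrier_mat n (p * s\<^sub>\<theta>)" and C\<theta>: "C\<theta> \<in> carrier_mat n p"
    and A\<theta>: "A\<theta> \<in> carrier_mat n\<^sub>\<theta> (m\<^sub>\<theta> * s\<^sub>\<theta>)" and B\<theta>: "B\<theta> \<in> carrier_mat n\<^sub>\<theta> m\<^sub>\<theta>"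
    using prior by (auto simp: cmz_data_def)
  have X1_c: "X1 \<in> carrier_mat n T" and X0_c: "X0 \<in> carrier_mat n T" and U0_c: "U0 \<in> carrier_mat m T"
    and Cw_c: "Cw \<in> carrier_mat n T"
    unfolding X1 X0 U0 Cw by (auto intro!: carrier_matI)
  have D0_c: "D0 \<in> carrier_mat p T" using X0_c U0_c by (simp add: D0 p)
  have Gw_c: "Gw \<in> carrier_mat n (T * ?S)"
    unfolding Gw disturbance_gens_def carrier_matD(1)[OF Gh] carrier_matD(2)[OF Gh]
    by (rule of_blocks_carrier)
  have Tb: "T \<le> b" "m\<^sub>\<theta> \<le> b" "T - p \<le> b" by (auto simp: b)
  have D0_Dperp: "D0 * Dperp = 0\<^sub>m p (T - p)"
  proof -
    interpret ker: kernel p T D0 by unfold_locales (rule D0_c)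
    have "set (cols Dperp) \<subseteq> mat_kernel D0"
      using Dperp_basis(2) by (simp add: ker.Ker.basis_def)
    then show ?thesis by (rule mat_kernel_cols_mult_zero[OF D0_c Dperp])
  qed

  have GwV: "block_mult ?S Gw V \<in> carrier_mat n (n * ?S)"
    using block_mult_carrier[OF Gw_c V] .
  have G\<theta>D: "block_mult s\<^sub>\<theta> G\<theta> D0 \<in> carrier_mat n (T * s\<^sub>\<theta>)"
    using block_mult_carrier[OF G\<theta> D0_c] .
  have Aw_c: "Aw \<in> carrier_mat n ((T - p) * ?S)"
    unfolding Aw by (rule block_mult_carrier[OF Gw_c Dperp])
  have Bw_c: "Bw \<in> carrier_mat n (T - p)" using X1_c Cw_c Dperp by (auto simp: Bw)
  have Aw'_c: "Aw' \<in> carrier_mat n (b * ?S)" unfolding Aw' by (rule pad_blocks_carrier[OF Aw_c])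
  have A\<theta>'_c: "A\<theta>' \<in> carrier_mat n\<^sub>\<theta> (b * s\<^sub>\<theta>)" unfolding A\<theta>' by (rule pad_blocks_carrier[OF A\<theta>])
  have Gw'_c: "Gw' \<in> carrier_mat n (b * ?S)" unfolding Gw' by (rule pad_blocks_carrier[OF Gw_c])
  have G\<theta>'_c: "G\<theta>' \<in> carrier_mat n (b * s\<^sub>\<theta>)"
    unfolding G\<theta>' using G\<theta>D by (intro pad_blocks_carrier[of _ n "T * s\<^sub>\<theta>"]) simp
  have C\<theta>D: "X1 - C\<theta> * D0 \<in> carrier_mat n T" using X1_c C\<theta> D0_c by auto
  \<comment> \<open>As a single padded matrix, the last block of \<open>BC\<close> becomes
    accessible to \<open>pad_cols_inject\<close>.\<close>
  have C'_c: "C\<theta>' - Cw' = pad_cols b (X1 - C\<theta> * D0 - Cw)"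
    unfolding C\<theta>' Cw' using C\<theta>D Cw_c by (simp add: pad_cols_minus)
  have BC_c: "BC \<in> carrier_mat (n + n\<^sub>\<theta> + n) b"
    unfolding BC C'_c Bw' B\<theta>' add.assoc
    by (intro carrier_append_rows pad_cols_carrier[OF Bw_c] pad_cols_carrier[OF B\<theta>]
        pad_cols_carrier[of _ n T]) (use C\<theta>D Cw_c in auto)
  have row1: "Aw' @\<^sub>c 0\<^sub>m n (b * s\<^sub>\<theta>) \<in> carrier_mat n (b * (?S + s\<^sub>\<theta>))"
    and row2: "0\<^sub>m n\<^sub>\<theta> (b * ?S) @\<^sub>c A\<theta>' \<in> carrier_mat n\<^sub>\<theta> (b * (?S + s\<^sub>\<theta>))"
    and row3: "Gw' @\<^sub>c (- G\<theta>') \<in> carrier_mat n (b * (?S + s\<^sub>\<theta>))"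
    unfolding distrib_left using Aw'_c A\<theta>'_c Gw'_c G\<theta>'_c by auto
  have AC_c: "AC \<in> carrier_mat (n + n\<^sub>\<theta> + n) (b * (?S + s\<^sub>\<theta>))"
    unfolding AC add.assoc using row1 row2 row3 by (intro carrier_append_rows)
  have Ccl_c: "?Ccl \<in> carrier_mat n n" using X1_c Cw_c V by auto
  have Gcl_c: "?Gcl \<in> carrier_mat n (n * (?S + s\<^sub>\<theta>))"
    unfolding distrib_left using GwV by auto
  have data: "cmz_data n n (n + n\<^sub>\<theta> + n) b (s\<^sub>\<theta> + ?S) ?Gcl ?Ccl AC BC"
    unfolding cmz_data_def using AC_c BC_c Ccl_c Gcl_c by (simp add: add.commute)

  define \<theta>_of where "\<theta>_of \<zeta> = C\<theta> + gen_comb p s\<^sub>\<theta> G\<theta> \<zeta>" for \<zeta>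
  define W_of where "W_of \<zeta> = Cw + gen_comb T ?S Gw \<zeta>" for \<zeta>
  have \<theta>_of_c: "\<theta>_of \<zeta> \<in> carrier_mat n p" for \<zeta>
    using C\<theta> gen_comb_carrier[OF G\<theta>] by (auto simp: \<theta>_of_def)
  have W_of_c: "W_of \<zeta> \<in> carrier_mat n T" for \<zeta>
    using Cw_c gen_comb_carrier[OF Gw_c] by (auto simp: W_of_def)
  have M_prior_eq: "M_prior = {\<theta>_of z | z. z \<in> carrier_vec s\<^sub>\<theta> \<and> inf_norm z \<le> 1 \<and>
      gen_comb m\<^sub>\<theta> s\<^sub>\<theta> A\<theta> z = B\<theta>}"
    unfolding M_prior cmz_def \<theta>_of_def using C\<theta> B\<theta> by simp
  have M_w_eq: "M_w = {W_of y | y. y \<in> carrier_vec ?S \<and> inf_norm y \<le> 1}"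
    unfolding M_w matrix_zonotope_def W_of_def using Cw_c by simp

  \<comment> \<open>The sign of the generators \<open>- block_mult ?S Gw V\<close> turns the centre
    (X1 - Cw) V into (X1 - Cw - G^w y) V; z drops out through the zero block.\<close>
  have centre: "?Ccl + gen_comb n (?S + s\<^sub>\<theta>) ?Gcl (y @\<^sub>v z) = (X1 - W_of y) * V"
    if y: "y \<in> carrier_vec ?S" and z: "z \<in> carrier_vec s\<^sub>\<theta>" for y z
  proof -
    let ?g = "gen_comb T ?S Gw y"
    have g: "?g \<in> carrier_mat n T" by (rule gen_comb_carrier[OF Gw_c])
    have "gen_comb n (?S + s\<^sub>\<theta>) ?Gcl (y @\<^sub>v z) =
        gen_comb n ?S (- block_mult ?S Gw V) y + gen_comb n s\<^sub>\<theta> (0\<^sub>m n (n * s\<^sub>\<theta>)) z"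
      using GwV y z by (intro gen_comb_append_cols[where n = n]) auto
    also have "\<dots> = - (?g * V)"
      using g V by (simp add: gen_comb_uminus[OF GwV] gen_comb_zero gen_comb_block_mult[OF Gw_c V])
    finally have "?Ccl + gen_comb n (?S + s\<^sub>\<theta>) ?Gcl (y @\<^sub>v z) = (X1 - Cw) * V - ?g * V"
      using Ccl_c g V by (auto simp: add_uminus_minus_mat)
    also have "\<dots> = (X1 - Cw - ?g) * V"
      using X1_c Cw_c g V by (intro minus_mult_distrib_mat[symmetric]) auto
    also have "X1 - Cw - ?g = X1 - W_of y"
      unfolding W_of_def using X1_c Cw_c g by (intro eq_matI) auto
    finally show ?thesis .
  qed

  have rows: "gen_comb b (?S + s\<^sub>\<theta>) AC (y @\<^sub>v z) = BC \<longleftrightarrow>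
      gen_comb T ?S Gw y * Dperp = (X1 - Cw) * Dperp \<and> gen_comb m\<^sub>\<theta> s\<^sub>\<theta> A\<theta> z = B\<theta> \<and>
      gen_comb T ?S Gw y + gen_comb p s\<^sub>\<theta> G\<theta> z * D0 = X1 - C\<theta> * D0 - Cw"
    if y: "y \<in> carrier_vec ?S" and z: "z \<in> carrier_vec s\<^sub>\<theta>" for y z
  proof -
    let ?g = "gen_comb T ?S Gw y" and ?h = "gen_comb p s\<^sub>\<theta> G\<theta> z"
    have g: "?g \<in> carrier_mat n T" by (rule gen_comb_carrier[OF Gw_c])
    have h: "?h \<in> carrier_mat n p" by (rule gen_comb_carrier[OF G\<theta>])
    have a: "gen_comb m\<^sub>\<theta> s\<^sub>\<theta> A\<theta> z \<in> carrier_mat n\<^sub>\<theta> m\<^sub>\<theta>" by (rule gen_comb_carrier[OF A\<theta>])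
    have gD: "?g * Dperp \<in> carrier_mat n (T - p)" using g Dperp by auto
    have ghD: "?g + ?h * D0 \<in> carrier_mat n T" using g h D0_c by auto
    have r1: "gen_comb b (?S + s\<^sub>\<theta>) (Aw' @\<^sub>c 0\<^sub>m n (b * s\<^sub>\<theta>)) (y @\<^sub>v z) = pad_cols b (?g * Dperp)"
      using gen_comb_append_cols[OF Aw'_c zero_carrier_mat y z] pad_cols_carrier[OF gD, of b]
      by (simp add: gen_comb_zero Aw' Aw gen_comb_pad_blocks gen_comb_block_mult[OF Gw_c Dperp])
    have r2: "gen_comb b (?S + s\<^sub>\<theta>) (0\<^sub>m n\<^sub>\<theta> (b * ?S) @\<^sub>c A\<theta>') (y @\<^sub>v z) =
        pad_cols b (gen_comb m\<^sub>\<theta> s\<^sub>\<theta> A\<theta> z)"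
      using gen_comb_append_cols[OF zero_carrier_mat A\<theta>'_c y z] pad_cols_carrier[OF a, of b]
      by (simp add: gen_comb_zero A\<theta>' gen_comb_pad_blocks)
    \<comment> \<open>\<open>G\<theta>'\<close> is the padding of a negated matrix, so the minus
      sign in \<open>AC\<close> cancels and the contribution of z enters positively.\<close>
    have "gen_comb b s\<^sub>\<theta> (- G\<theta>') z = pad_cols b (?h * D0)"
      unfolding gen_comb_uminus[OF G\<theta>'_c]
      by (simp add: G\<theta>' gen_comb_pad_blocks gen_comb_uminus[OF G\<theta>D]
          gen_comb_block_mult[OF G\<theta> D0_c] pad_cols_uminus)
    moreover have "pad_cols b (?g + ?h * D0) = pad_cols b ?g + pad_cols b (?h * D0)"
      using g h D0_c by (intro pad_cols_add) auto
    ultimately have r3: "gen_comb b (?S + s\<^sub>\<theta>) (Gw' @\<^sub>c (- G\<theta>')) (y @\<^sub>v z) =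
        pad_cols b (?g + ?h * D0)"
      using gen_comb_append_cols[OF Gw'_c uminus_carrier_mat[OF G\<theta>'_c] y z]
      by (simp add: Gw' gen_comb_pad_blocks)
    have X: "X1 - C\<theta> * D0 - Cw \<in> carrier_mat n T" using C\<theta>D Cw_c by auto
    have row23: "(0\<^sub>m n\<^sub>\<theta> (b * ?S) @\<^sub>c A\<theta>') @\<^sub>r (Gw' @\<^sub>c (- G\<theta>')) \<in>
        carrier_mat (n\<^sub>\<theta> + n) (b * (?S + s\<^sub>\<theta>))"
      using row2 row3 by (rule carrier_append_rows)
    have "gen_comb b (?S + s\<^sub>\<theta>) AC (y @\<^sub>v z) = pad_cols b (?g * Dperp) @\<^sub>r
        pad_cols b (gen_comb m\<^sub>\<theta> s\<^sub>\<theta> A\<theta> z) @\<^sub>r pad_cols b (?g + ?h * D0)"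
      unfolding AC gen_comb_append_rows[OF row1 row23] gen_comb_append_rows[OF row2 row3] r1 r2 r3 ..
    also have "\<dots> = BC \<longleftrightarrow> pad_cols b (?g * Dperp) = Bw' \<and>
        pad_cols b (gen_comb m\<^sub>\<theta> s\<^sub>\<theta> A\<theta> z) @\<^sub>r pad_cols b (?g + ?h * D0) = B\<theta>' @\<^sub>r (C\<theta>' - Cw')"
      unfolding BC C'_c Bw' B\<theta>'
      by (rule append_rows_inject[OF pad_cols_carrier[OF gD] pad_cols_carrier[OF Bw_c]
            carrier_append_rows[OF pad_cols_carrier[OF a] pad_cols_carrier[OF ghD]]
            carrier_append_rows[OF pad_cols_carrier[OF B\<theta>] pad_cols_carrier[OF X]]])
    also have "\<dots> \<longleftrightarrow> pad_cols b (?g * Dperp) = Bw' \<and> pad_cols b (gen_comb m\<^sub>\<theta> s\<^sub>\<theta> A\<theta> z) = B\<theta>' \<and>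
        pad_cols b (?g + ?h * D0) = C\<theta>' - Cw'"
      unfolding C'_c B\<theta>'
      by (simp only: append_rows_inject[OF pad_cols_carrier[OF a] pad_cols_carrier[OF B\<theta>]
            pad_cols_carrier[OF ghD] pad_cols_carrier[OF X]])
    \<comment> \<open>Each of the three width bounds in \<open>Tb\<close> removes the padding from
      one block row.\<close>
    also have "\<dots> \<longleftrightarrow> ?g * Dperp = (X1 - Cw) * Dperp \<and> gen_comb m\<^sub>\<theta> s\<^sub>\<theta> A\<theta> z = B\<theta> \<and>
        ?g + ?h * D0 = X1 - C\<theta> * D0 - Cw"
      unfolding C'_c B\<theta>' Bw'
        pad_cols_inject[OF gD Bw_c Tb(3)] pad_cols_inject[OF a B\<theta> Tb(2)] pad_cols_inject[OF ghD X Tb(1)]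
      by (simp add: Bw)
    finally show ?thesis .
  qed

  have constraint: "gen_comb b (?S + s\<^sub>\<theta>) AC (y @\<^sub>v z) = BC \<longleftrightarrow>
      gen_comb m\<^sub>\<theta> s\<^sub>\<theta> A\<theta> z = B\<theta> \<and> X1 = \<theta>_of z * D0 + W_of y"
    if y: "y \<in> carrier_vec ?S" and z: "z \<in> carrier_vec s\<^sub>\<theta>" for y z
  proof -
    let ?g = "gen_comb T ?S Gw y" and ?h = "gen_comb p s\<^sub>\<theta> G\<theta> z"
    have g: "?g \<in> carrier_mat n T" by (rule gen_comb_carrier[OF Gw_c])
    have h: "?h \<in> carrier_mat n p" by (rule gen_comb_carrier[OF G\<theta>])
    have "\<theta>_of z * D0 + W_of y = (C\<theta> * D0 + ?h * D0) + (Cw + ?g)"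
      unfolding \<theta>_of_def W_of_def by (subst add_mult_distrib_mat[OF C\<theta> h D0_c]) simp
    \<comment> \<open>Stated for arbitrary P and H so that the entrywise rearrangement does not
      unfold the matrix products they stand for.\<close>
    moreover have "?g + H = X1 - P - Cw \<longleftrightarrow> X1 = (P + H) + (Cw + ?g)"
      if "P \<in> carrier_mat n T" "H \<in> carrier_mat n T" for P H
      using that g X1_c Cw_c by (auto simp: mat_eq_iff algebra_simps)
    ultimately have eq: "?g + ?h * D0 = X1 - C\<theta> * D0 - Cw \<longleftrightarrow> X1 = \<theta>_of z * D0 + W_of y"
      using C\<theta> h D0_c by simp
    have "?g * Dperp = (X1 - Cw) * Dperp" if X1_eq: "X1 = \<theta>_of z * D0 + W_of y"
    proof -
      have TD: "\<theta>_of z * D0 \<in> carrier_mat n T" by (rule mult_carrier_mat[OF \<theta>_of_c D0_c])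
      have "X1 - Cw = \<theta>_of z * D0 + ?g"
        using TD Cw_c g by (subst X1_eq, unfold W_of_def) (intro eq_matI, auto)
      then have "(X1 - Cw) * Dperp = \<theta>_of z * D0 * Dperp + ?g * Dperp"
        using add_mult_distrib_mat[OF TD g Dperp] by simp
      also have "\<theta>_of z * D0 * Dperp = 0\<^sub>m n (T - p)"
        using assoc_mult_mat[OF \<theta>_of_c D0_c Dperp] D0_Dperp \<theta>_of_c[of z] by simp
      also have "\<dots> + ?g * Dperp = ?g * Dperp"
        using g Dperp by (intro left_add_zero_mat) auto
      finally show ?thesis by simp
    qed
    then show ?thesis unfolding rows[OF y z] eq by blast
  qed

  have closed_loop: "(X1 - W) * V = A + B * K"
    if A: "A \<in> carrier_mat n n" and B: "B \<in> carrier_mat n m" and W: "W \<in> carrier_mat n T"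
      and X1_eq: "X1 = (A @\<^sub>c B) * D0 + W" for A B W
  proof -
    have AB: "A @\<^sub>c B \<in> carrier_mat n p" using A B by (simp add: p)
    have "P + W - W = P" if "P \<in> carrier_mat n T" for P
      using that W by (intro eq_matI) auto
    then have "X1 - W = (A @\<^sub>c B) * D0"
      unfolding X1_eq using mult_carrier_mat[OF AB D0_c] by blast
    then have "(X1 - W) * V = (A @\<^sub>c B) * (1\<^sub>m n @\<^sub>r K)"
      using assoc_mult_mat[OF AB D0_c V] K_V by simp
    also have "\<dots> = A + B * K"
      using append_cols_mult_append_rows[OF A B one_carrier_mat K] A by simp
    finally show ?thesis .
  qed

  have M_cl_eq: "M_cl = {(X1 - W_of y) * V | y z. y \<in> carrier_vec ?S \<and> z \<in> carrier_vec s\<^sub>\<theta> \<and>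
      inf_norm y \<le> 1 \<and> inf_norm z \<le> 1 \<and> gen_comb m\<^sub>\<theta> s\<^sub>\<theta> A\<theta> z = B\<theta> \<and>
      X1 = \<theta>_of z * D0 + W_of y}" (is "_ = ?R")
  proof -
    have dims: "dim_col ?Ccl = n" "dim_col BC = b" using V BC_c by auto
    have "M_cl = {?Ccl + gen_comb n (?S + s\<^sub>\<theta>) ?Gcl \<zeta> | \<zeta>. \<zeta> \<in> carrier_vec (?S + s\<^sub>\<theta>) \<and>
        inf_norm \<zeta> \<le> 1 \<and> gen_comb b (?S + s\<^sub>\<theta>) AC \<zeta> = BC}"
      \<comment> \<open>The generator count is written with \<open>s\<^sub>\<theta>\<close> first,
        whereas the columns of the generators list the disturbance blocks first; swapping the
        summands lets the parameter split as \<open>y @\<^sub>v z\<close>.\<close>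
      unfolding M_cl cmz_def dims add.commute[of s\<^sub>\<theta>] ..
    also have "\<dots> = {?Ccl + gen_comb n (?S + s\<^sub>\<theta>) ?Gcl (y @\<^sub>v z) | y z.
        y \<in> carrier_vec ?S \<and> z \<in> carrier_vec s\<^sub>\<theta> \<and>
        inf_norm (y @\<^sub>v z) \<le> 1 \<and> gen_comb b (?S + s\<^sub>\<theta>) AC (y @\<^sub>v z) = BC}"
    proof (intro equalityI subsetI; elim CollectE exE conjE)
      fix M \<zeta> assume M: "M = ?Ccl + gen_comb n (?S + s\<^sub>\<theta>) ?Gcl \<zeta>"
        and \<zeta>: "\<zeta> \<in> carrier_vec (?S + s\<^sub>\<theta>)" "inf_norm \<zeta> \<le> 1" "gen_comb b (?S + s\<^sub>\<theta>) AC \<zeta> = BC"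
      have "vec_first \<zeta> ?S @\<^sub>v vec_last \<zeta> s\<^sub>\<theta> = \<zeta>" using \<zeta>(1) by simp
      then show "M \<in> {?Ccl + gen_comb n (?S + s\<^sub>\<theta>) ?Gcl (y @\<^sub>v z) | y z.
          y \<in> carrier_vec ?S \<and> z \<in> carrier_vec s\<^sub>\<theta> \<and>
          inf_norm (y @\<^sub>v z) \<le> 1 \<and> gen_comb b (?S + s\<^sub>\<theta>) AC (y @\<^sub>v z) = BC}"
        using M \<zeta>(2,3)
        by (intro CollectI exI[of _ "vec_first \<zeta> ?S"] exI[of _ "vec_last \<zeta> s\<^sub>\<theta>"]) simp
    qed auto
    also have "\<dots> = ?R"
    proof (intro Collect_cong ex_cong1)
      fix M y z
      show "(M = ?Ccl + gen_comb n (?S + s\<^sub>\<theta>) ?Gcl (y @\<^sub>v z) \<and> y \<in> carrier_vec ?S \<and> z \<in> carrier_vec s\<^sub>\<theta> \<and>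
            inf_norm (y @\<^sub>v z) \<le> 1 \<and> gen_comb b (?S + s\<^sub>\<theta>) AC (y @\<^sub>v z) = BC) \<longleftrightarrow>
          (M = (X1 - W_of y) * V \<and> y \<in> carrier_vec ?S \<and> z \<in> carrier_vec s\<^sub>\<theta> \<and>
            inf_norm y \<le> 1 \<and> inf_norm z \<le> 1 \<and> gen_comb m\<^sub>\<theta> s\<^sub>\<theta> A\<theta> z = B\<theta> \<and>
            X1 = \<theta>_of z * D0 + W_of y)"
        using centre[of y z] inf_norm_append_vec_le_one_iff[of y ?S z s\<^sub>\<theta>] constraint[of y z] by metis
    qed
    finally show ?thesis .
  qed

  \<comment> \<open>The two inclusions, and a witness for non-emptiness\<close>
  have "\<Sigma>K = M_cl"
  proof (intro equalityI subsetI)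
    fix M assume "M \<in> \<Sigma>K"
    then obtain A B where A: "A \<in> carrier_mat n n" and B: "B \<in> carrier_mat n m"
      and AB: "A @\<^sub>c B \<in> \<Sigma>" and M: "M = A + B * K"
      by (auto simp: \<Sigma>K)
    obtain y z where z: "z \<in> carrier_vec s\<^sub>\<theta>" "inf_norm z \<le> 1" "gen_comb m\<^sub>\<theta> s\<^sub>\<theta> A\<theta> z = B\<theta>"
      "A @\<^sub>c B = \<theta>_of z" and y: "y \<in> carrier_vec ?S" "inf_norm y \<le> 1"
      and X1_eq: "X1 = (A @\<^sub>c B) * D0 + W_of y"
      using AB unfolding \<Sigma> M_prior_eq M_w_eq by blast
    have "M = (X1 - W_of y) * V" using closed_loop[OF A B W_of_c X1_eq] M by simp
    then show "M \<in> M_cl" unfolding M_cl_eq using y z X1_eq by auto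
  next
    fix M assume "M \<in> M_cl"
    then obtain y z where yz: "y \<in> carrier_vec ?S" "inf_norm y \<le> 1" "z \<in> carrier_vec s\<^sub>\<theta>"
      "inf_norm z \<le> 1" "gen_comb m\<^sub>\<theta> s\<^sub>\<theta> A\<theta> z = B\<theta>"
      and X1_eq: "X1 = \<theta>_of z * D0 + W_of y" and M: "M = (X1 - W_of y) * V"
      unfolding M_cl_eq by blast
    obtain A B where A: "A \<in> carrier_mat n n" and B: "B \<in> carrier_mat n m"
      and AB: "\<theta>_of z = A @\<^sub>c B"
      using split_cols[of "\<theta>_of z" n n m] \<theta>_of_c p by metis
    have "M = A + B * K" using closed_loop[OF A B W_of_c X1_eq[unfolded AB]] M by simp
    moreover have "\<theta>_of z \<in> \<Sigma>"
      unfolding \<Sigma> M_prior_eq M_w_eq using yz X1_eq by blast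
    ultimately show "M \<in> \<Sigma>K" unfolding \<Sigma>K AB using A B by blast
  qed

  moreover have "As + Bs * K \<in> \<Sigma>K"
  proof -
    \<comment> \<open>The disturbances that occurred while the data were collected; with the true
      parameters they explain the data.\<close>
    define W where "W = mat_of_cols n (map w [0..<T])"
    have w_c: "w t \<in> carrier_vec n" if "t < T" for t
      using w[OF that] Gh ch by (auto simp: zonotope_def)
    have W_c: "W \<in> carrier_mat n T" unfolding W_def by (rule carrier_matI) simp_all
    have "col W t \<in> zonotope Gh ch" if "t < T" for t
      using that w[OF that] w_c[OF that] by (simp add: W_def)
    then have "W \<in> M_w"
      unfolding M_w Gw Cw by (intro matrix_zonotope_disturbance_gens[OF Gh ch enum W_c])
    moreover have "X1 = \<theta>s * D0 + W"
    proof -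
      have "\<theta>s * D0 = As * X0 + Bs * U0"
        unfolding \<theta>s D0 by (rule append_cols_mult_append_rows[OF As Bs X0_c U0_c])
      \<comment> \<open>Column t of this equation is the system dynamics at time t.\<close>
      moreover have "X1 = As * X0 + Bs * U0 + W"
      proof (rule mat_col_eqI)
        fix t assume "t < dim_col (As * X0 + Bs * U0 + W)"
        then have t: "t < T" using W_c by simp
        have "col X0 t = x t" "col U0 t = u t" "col W t = w t" "col X1 t = x (t + 1)"
          using t x[of t] x[of "t + 1"] u[OF t] w_c[OF t] by (simp_all add: X0 U0 W_def X1)
        moreover have "col (As * X0 + Bs * U0 + W) t = col (As * X0) t + col (Bs * U0) t + col W t"
          using t As Bs X0_c U0_c W_c by (intro eq_vecI) auto
        moreover have "col (As * X0) t = As *\<^sub>v col X0 t" "col (Bs * U0) t = Bs *\<^sub>v col U0 t"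
          using col_mult2[OF As X0_c t] col_mult2[OF Bs U0_c t] .
        ultimately show "col X1 t = col (As * X0 + Bs * U0 + W) t"
          using dyn[OF t] by simp
      qed (use X1_c W_c in auto)
      ultimately show ?thesis by simp
    qed
    ultimately have "As @\<^sub>c Bs \<in> \<Sigma>" using \<theta>s_prior by (auto simp: \<Sigma> \<theta>s)
    then show ?thesis unfolding \<Sigma>K using As Bs by blast
  qed
  moreover have "compactin (mat_topology n n) M_cl"
    unfolding M_cl by (rule compactin_cmz[OF data])
  ultimately show ?thesis using data by blast
qed

end
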